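(* Let $\xi=(\xi_j)_{j\ge1}$ be a random sequence that is swap-invariant under a probability measure $\mathbf{P}$ such that $n^{-1}\sum_{j=1}^n\xi_j\to X$ $\mathbf{P}$-almost surely and in $L^1(\mathbf{P})$ as $n\to\infty$, where $X$ is a random variable with $\mathbf{P}(X\neq0)=1$. Then there exists a random sequence $\eta=(\eta_j)_{j\ge1}$ that is exchangeable and integrable under the probability measure $\mathbf{Q}$ defined by $$\frac{\mathrm{d}\mathbf{Q}}{\mathrm{d}\mathbf{P}}=\frac{|X|}{\mathbf{E}_{\mathbf{P}}|X|}$$ such that $\xi=X\eta$ $\mathbf{P}$-almost surely.
   Context: Random sequences are sequences of real-valued random variables. A sequence $\xi$ of integrable random variables is swap-invariant if for every $n\ge1$, every permutation $\pi$ of $\{1,\dots,n\}$ and every $u\in\mathbb{R}^n$, $\mathbf{E}\,\big|\sum_{j=1}^n u_j\xi_j\big|=\mathbf{E}\,\big|\sum_{j=1}^n u_j\xi_{\pi(j)}\big|$. It is exchangeable if for every $n\ge1$ and every such $\pi$, $(\xi_{\pi(1)},\dots,\xi_{\pi(n)})$ and $(\xi_1,\dots,\xi_n)$ have the same distribution. A sequence is integrable if each of its members is integrable. $\mathbf{E}_{\mathbf{P}}$ denotes expectation with respect to $\mathbf{P}$. *)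

theory Defs
  imports "HOL-Probability.Probability"
begin

(* A sequence (\<xi>_j)_{j \<ge> 1} is a function on nat of which only the values at indices
   j \<ge> 1 are used; the value at index 0 is never constrained. *)

definition random_sequence :: "'a measure \<Rightarrow> (nat \<Rightarrow> 'a \<Rightarrow> real) \<Rightarrow> bool" where
  "random_sequence M \<xi> \<longleftrightarrow> (\<forall>j\<ge>1. \<xi> j \<in> borel_measurable M)"

definition integrable_sequence :: "'a measure \<Rightarrow> (nat \<Rightarrow> 'a \<Rightarrow> real) \<Rightarrow> bool" where
  "integrable_sequence M \<xi> \<longleftrightarrow> (\<forall>j\<ge>1. integrable M (\<xi> j))"

definition swap_invariant :: "'a measure \<Rightarrow> (nat \<Rightarrow> 'a \<Rightarrow> real) \<Rightarrow> bool" where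
  "swap_invariant M \<xi> \<longleftrightarrow>
     integrable_sequence M \<xi> \<and>
     (\<forall>n\<ge>1. \<forall>\<pi>. \<pi> permutes {1..n} \<longrightarrow>
        (\<forall>u :: nat \<Rightarrow> real.
           (\<integral>\<omega>. \<bar>\<Sum>j=1..n. u j * \<xi> j \<omega>\<bar> \<partial>M) =
           (\<integral>\<omega>. \<bar>\<Sum>j=1..n. u j * \<xi> (\<pi> j) \<omega>\<bar> \<partial>M)))"

definition exchangeable :: "'a measure \<Rightarrow> (nat \<Rightarrow> 'a \<Rightarrow> real) \<Rightarrow> bool" where
  "exchangeable M \<xi> \<longleftrightarrow>
     random_sequence M \<xi> \<and>
     (\<forall>n\<ge>1. \<forall>\<pi>. \<pi> permutes {1..n} \<longrightarrow>
        distr M (\<Pi>\<^sub>M j\<in>{1..n}. borel) (\<lambda>\<omega>. \<lambda>j\<in>{1..n}. \<xi> (\<pi> j) \<omega>) =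
        distr M (\<Pi>\<^sub>M j\<in>{1..n}. borel) (\<lambda>\<omega>. \<lambda>j\<in>{1..n}. \<xi> j \<omega>))"

(* The integrability clauses are essential: the Bochner integral of a non-integrable
   function is 0 by convention. *)
definition tendsto_L1 :: "'a measure \<Rightarrow> (nat \<Rightarrow> 'a \<Rightarrow> real) \<Rightarrow> ('a \<Rightarrow> real) \<Rightarrow> bool" where
  "tendsto_L1 M f g \<longleftrightarrow>
     (\<forall>n. integrable M (f n)) \<and> integrable M g \<and>
     (\<lambda>n. \<integral>\<omega>. \<bar>f n \<omega> - g \<omega>\<bar> \<partial>M) \<longlonglongrightarrow> 0"

(* At n = 0 the average is 0, which is irrelevant for limits. *)
definition average :: "(nat \<Rightarrow> 'a \<Rightarrow> real) \<Rightarrow> nat \<Rightarrow> 'a \<Rightarrow> real" where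
  "average \<xi> n \<omega> = (\<Sum>j=1..n. \<xi> j \<omega>) / real n"

definition abs_weighted :: "'a measure \<Rightarrow> ('a \<Rightarrow> real) \<Rightarrow> 'a measure" where
  "abs_weighted M X =
     density M (\<lambda>\<omega>. ennreal (\<bar>X \<omega>\<bar> / (\<integral>\<omega>'. \<bar>X \<omega>'\<bar> \<partial>M)))"

end

theory Submission
  imports Defs
begin

text \<open>Put \<open>\<eta>\<^sub>j = \<xi>\<^sub>j / X\<close>. Adding \<open>t\<close> times the average of the first \<open>m\<close> terms to a linear
  combination of \<open>\<xi>\<^sub>1, \<dots>, \<xi>\<^sub>n\<close> and letting \<open>m \<rightarrow> \<infinity>\<close>, swap-invariance shows that
  \<open>E\<^sub>P |\<Sum> u\<^sub>j \<xi>\<^sub>j + t X| = E\<^sub>P |X| \<cdot> E\<^sub>Q |\<Sum> u\<^sub>j \<eta>\<^sub>j + t|\<close> does not change when the \<open>\<xi>\<^sub>j\<close> are permuted.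
  The function \<open>t \<mapsto> E |Y + t|\<close> determines the law of \<open>Y\<close>, since its difference quotients
  converge to \<open>2 P(Y \<le> a) - 1\<close>. Hence all one-dimensional marginals \<open>\<Sum> u\<^sub>j \<eta>\<^sub>j\<close> are invariant under
  permutations, and the Cramer-Wold theorem gives exchangeability.\<close>

section \<open>Fourier uniqueness for weighted laws on the line\<close>

text \<open>The imaginary part of the characteristic function is written as a phase-shifted cosine, so that
  the family \<open>cos (a + t * h x)\<close> alone controls both parts.\<close>

lemma weighted_law:
  fixes h u :: "'a \<Rightarrow> real"
  assumes [measurable]: "h \<in> borel_measurable L" and u: "integrable L u" "\<And>x. 0 \<le> u x"
    and c: "(\<integral>x. u x \<partial>L) = c" "c > 0"
  defines "\<mu> \<equiv> distr (density L (\<lambda>x. ennreal (u x / c))) borel h"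
  shows real_distribution_weighted_law: "real_distribution \<mu>"
    and char_weighted_law: "char \<mu> t =
      Complex ((\<integral>x. u x * cos (0 + t * h x) \<partial>L) / c)
        ((\<integral>x. u x * cos (- pi / 2 + t * h x) \<partial>L) / c)"
    and measure_weighted_law: "B \<in> sets borel \<Longrightarrow>
      measure \<mu> B = (\<integral>x. u x * indicator B (h x) \<partial>L) / c"
proof -
  have [measurable]: "u \<in> borel_measurable L"
    using u by auto
  have "prob_space (density L (\<lambda>x. ennreal (u x / c)))"
    using u c
    by (intro prob_spaceI)
      (simp add: emeasure_density nn_integral_eq_integral cong: nn_integral_cong_simp)
  then show rd: "real_distribution \<mu>"
    unfolding \<mu>_def
    by (intro prob_space.real_distribution_distr) auto
  have [simp]: "integrable L (\<lambda>x. u x * k x)"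
    if [measurable]: "k \<in> borel_measurable L" and "\<And>x. \<bar>k x\<bar> \<le> 1" for k
    using that u
    by (intro Bochner_Integration.integrable_bound[OF u(1)])
      (auto simp: abs_mult intro!: mult_left_le)
  have iexp: "iexp (t * h x) =
      of_real (cos (0 + t * h x)) + \<i> * of_real (cos (- pi / 2 + t * h x))" for x
    by (simp add: complex_eq_iff cos_diff Re_exp Im_exp)
  have "char \<mu> t = (CLINT x|L. (u x / c) *\<^sub>R iexp (t * h x))"
    using c u unfolding char_def \<mu>_def
    by (subst integral_distr) (auto simp: integral_density)
  also have "\<dots> = (CLINT x|L. of_real (u x * cos (0 + t * h x) / c) +
      \<i> * of_real (u x * cos (- pi / 2 + t * h x) / c))"
    by (intro Bochner_Integration.integral_cong refl, subst iexp)
      (simp add: scaleR_conv_of_real add_divide_distrib algebra_simps)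
  also have "\<dots> = Complex ((\<integral>x. u x * cos (0 + t * h x) \<partial>L) / c)
     ((\<integral>x. u x * cos (- pi / 2 + t * h x) \<partial>L) / c)"
    by (subst Bochner_Integration.integral_add)
      (auto simp: complex_eq_iff simp del: of_real_mult of_real_divide)
  finally show "char \<mu> t = \<dots>" .
  assume [measurable]: "B \<in> sets borel"
  have "measure \<mu> B = (\<integral>x. indicator B x \<partial>\<mu>)"
    using real_distribution.events_eq_borel[OF rd] by simp
  also have "\<dots> = (\<integral>x. u x / c * indicator B (h x) \<partial>L)"
    using c u unfolding \<mu>_def
    by (subst integral_distr) (auto simp: integral_density)
  finally show "measure \<mu> B = (\<integral>x. u x * indicator B (h x) \<partial>L) / c"
    by simp
qed

text \<open>Dividing by the common total mass turns both weights into probability densities, and by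
  \<open>weighted_law\<close> the cosine integrals with phases 0 and -pi/2 are the real and
  imaginary parts of the characteristic functions. Levy uniqueness then identifies the laws.
  Arbitrary finite mass is allowed because the weights that arise later are not normalised.\<close>

lemma weighted_cos_determines:
  fixes f :: "'a \<Rightarrow> real" and g :: "'b \<Rightarrow> real"
  assumes f[measurable]: "f \<in> borel_measurable M" and g[measurable]: "g \<in> borel_measurable N"
    and v: "integrable M v" "\<And>x. 0 \<le> v x"
    and w: "integrable N w" "\<And>x. 0 \<le> w x"
    and eq: "\<And>a t. (\<integral>x. v x * cos (a + t * f x) \<partial>M) = (\<integral>x. w x * cos (a + t * g x) \<partial>N)"
    and B[measurable]: "B \<in> sets borel"
  shows "(\<integral>x. v x * indicator B (f x) \<partial>M) = (\<integral>x. w x * indicator B (g x) \<partial>N)"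
proof -
  have [measurable]: "v \<in> borel_measurable M" "w \<in> borel_measurable N"
    using v(1) w(1) by auto
  \<comment> \<open>Since cos 0 = 1, phase 0 and frequency 0 in \<open>eq\<close> compare the total
    masses.\<close>
  obtain c where c: "(\<integral>x. v x \<partial>M) = c" "(\<integral>x. w x \<partial>N) = c"
    using eq[of 0 0] by simp
  have "c \<ge> 0"
    using c v by (auto intro: integral_nonneg_AE)
  then consider "c = 0" | "c > 0"
    by linarith
  then show ?thesis
  proof cases
    case 1
    \<comment> \<open>A weight of mass zero cannot be normalised, but it vanishes almost everywhere,
      so both integrals are 0.\<close>
    have z: "AE x in M. v x = 0" "AE x in N. w x = 0"
      using 1 c v w by (simp_all add: integral_nonneg_eq_0_iff_AE)
    show ?thesis
      by (subst (1 2) integral_eq_zero_AE) (use z in auto)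
  next
    case 2
    note mu = weighted_law[OF f v c(1) 2] and nu = weighted_law[OF g w c(2) 2]
    have "distr (density M (\<lambda>x. ennreal (v x / c))) borel f =
        distr (density N (\<lambda>x. ennreal (w x / c))) borel g"
      by (rule Levy_uniqueness[OF mu(1) nu(1) ext]) (simp only: mu(2) nu(2) eq)
    then show ?thesis
      using mu(3)[OF B] nu(3)[OF B] 2 by simp
  qed
qed


section \<open>From linear combinations to joint laws (Cramer-Wold)\<close>

text \<open>This is 2 cos A cos B = cos (A + B) + cos (A - B) under the integral; boundedness of
  \<open>p\<close> gives integrability. Every term on the right, including the one with the dummy
  summand \<open>0 * s x\<close>, has the shape of the hypothesis \<open>eq\<close> of the next
  lemma.\<close>

lemma (in prob_space) integral_one_plus_cos_times_cos:
  fixes p s f :: "'a \<Rightarrow> real"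
  assumes [measurable]: "p \<in> borel_measurable M" "s \<in> borel_measurable M" "f \<in> borel_measurable M"
    and p: "\<And>x. \<bar>p x\<bar> \<le> 1"
  shows "(\<integral>x. p x * (1 + cos (b + c * s x)) * cos (d + t * f x) \<partial>M) =
    (\<integral>x. p x * cos (d + (t * f x + 0 * s x)) \<partial>M)
      + ((\<integral>x. p x * cos ((d + b) + (t * f x + c * s x)) \<partial>M)
      + (\<integral>x. p x * cos ((b - d) + (- t * f x + c * s x)) \<partial>M)) / 2"
proof -
  have int: "integrable M (\<lambda>x. p x * cos (h x))" if [measurable]: "h \<in> borel_measurable M" for h
    using mult_mono[OF p abs_cos_le_one]
    by (intro integrable_const_bound[where B=1]) (auto simp: abs_mult)
  have "p x * (1 + cos (b + c * s x)) * cos (d + t * f x) = p x * cos (d + (t * f x + 0 * s x)) +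
      (p x * cos ((d + b) + (t * f x + c * s x)) + p x * cos ((b - d) + (- t * f x + c * s x))) / 2" for x
  proof -
    have e: "(d + b) + (t * f x + c * s x) = (b + c * s x) + (d + t * f x)"
      "(b - d) + (- t * f x + c * s x) = (b + c * s x) - (d + t * f x)"
      by simp_all
    show ?thesis
      unfolding e cos_add[of "b + c * s x"] cos_diff[of "b + c * s x"] by (simp add: algebra_simps)
  qed
  then show ?thesis
    by (simp add: int)
qed

text \<open>One exchange of a cosine for an indicator. A cosine changes sign and cannot serve as a
  density, but \<open>1 + cos\<close> can: one-dimensional uniqueness applies to \<open>f\<close>
  under the weight \<open>p x * (1 + cos (b + c * s x))\<close>, and the contribution of the
  constant 1 is subtracted afterwards.\<close>

lemma cos_determines_indicator_times_cos:
  fixes p s f :: "'a \<Rightarrow> real" and q r g :: "'b \<Rightarrow> real"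
  assumes "prob_space M" "prob_space N"
    and M[measurable]: "p \<in> borel_measurable M" "s \<in> borel_measurable M" "f \<in> borel_measurable M"
    and N[measurable]: "q \<in> borel_measurable N" "r \<in> borel_measurable N" "g \<in> borel_measurable N"
    and p: "\<And>x. 0 \<le> p x" "\<And>x. p x \<le> 1"
    and q: "\<And>x. 0 \<le> q x" "\<And>x. q x \<le> 1"
    and eq: "\<And>a t c. (\<integral>x. p x * cos (a + (t * f x + c * s x)) \<partial>M) =
      (\<integral>x. q x * cos (a + (t * g x + c * r x)) \<partial>N)"
    and B[measurable]: "B \<in> sets borel"
  shows "(\<integral>x. p x * indicator B (f x) * cos (a + s x) \<partial>M) =
    (\<integral>x. q x * indicator B (g x) * cos (a + r x) \<partial>N)"
proof -
  interpret M: prob_space M by fact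
  interpret N: prob_space N by fact
  have cos1: "0 \<le> 1 + cos z" for z :: real
    using cos_ge_minus_one[of z] by linarith
  have intM: "integrable M (\<lambda>x. p x * h x)"
    if [measurable]: "h \<in> borel_measurable M" and "\<And>x. \<bar>h x\<bar> \<le> C" for h and C :: real
    using mult_mono[OF p(2) that(2)] p
    by (intro M.integrable_const_bound[where B=C]) (auto simp: abs_mult)
  have intN: "integrable N (\<lambda>x. q x * h x)"
    if [measurable]: "h \<in> borel_measurable N" and "\<And>x. \<bar>h x\<bar> \<le> C" for h and C :: real
    using mult_mono[OF q(2) that(2)] q
    by (intro N.integrable_const_bound[where B=C]) (auto simp: abs_mult)
  have abs1: "\<bar>p x\<bar> \<le> 1" "\<bar>q y\<bar> \<le> 1" for x y
    using p q by simp_all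
  have c2: "\<bar>1 + cos z\<bar> \<le> 2" for z :: real
    using cos1[of z] cos_le_one[of z] by linarith
  have weighted: "(\<integral>x. p x * (1 + cos (b + c * s x)) * indicator B (f x) \<partial>M) =
      (\<integral>x. q x * (1 + cos (b + c * r x)) * indicator B (g x) \<partial>N)" for b c
  proof (rule weighted_cos_determines)
    show "integrable M (\<lambda>x. p x * (1 + cos (b + c * s x)))"
      by (rule intM[OF _ c2]) simp
    show "integrable N (\<lambda>x. q x * (1 + cos (b + c * r x)))"
      by (rule intN[OF _ c2]) simp
    show "0 \<le> p x * (1 + cos (b + c * s x))" "0 \<le> q y * (1 + cos (b + c * r y))" for x y
      using p q cos1 by simp_all
    show "(\<integral>x. p x * (1 + cos (b + c * s x)) * cos (d + t * f x) \<partial>M) =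
        (\<integral>x. q x * (1 + cos (b + c * r x)) * cos (d + t * g x) \<partial>N)" for d t
      by (simp only: M.integral_one_plus_cos_times_cos[OF M abs1(1)]
          N.integral_one_plus_cos_times_cos[OF N abs1(2)] eq)
  qed simp_all
  have bnd: "\<bar>indicator B y :: real\<bar> \<le> 1" "\<bar>indicator B y * cos z :: real\<bar> \<le> 1" for y z :: real
    by (auto simp: indicator_def)
  have "(\<integral>x. p x * (1 + cos (b + c * s x)) * indicator B (f x) \<partial>M) =
      (\<integral>x. p x * indicator B (f x) \<partial>M) + (\<integral>x. p x * (indicator B (f x) * cos (b + c * s x)) \<partial>M)" for b c
    by (subst Bochner_Integration.integral_add[symmetric])
      (auto intro!: intM[OF _ bnd(1)] intM[OF _ bnd(2)] simp: algebra_simps)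
  moreover have "(\<integral>x. q x * (1 + cos (b + c * r x)) * indicator B (g x) \<partial>N) =
      (\<integral>x. q x * indicator B (g x) \<partial>N) + (\<integral>x. q x * (indicator B (g x) * cos (b + c * r x)) \<partial>N)" for b c
    by (subst Bochner_Integration.integral_add[symmetric])
      (auto intro!: intN[OF _ bnd(1)] intN[OF _ bnd(2)] simp: algebra_simps)
  ultimately have eq: "(\<integral>x. p x * indicator B (f x) \<partial>M) + (\<integral>x. p x * (indicator B (f x) * cos (b + c * s x)) \<partial>M) =
      (\<integral>x. q x * indicator B (g x) \<partial>N) + (\<integral>x. q x * (indicator B (g x) * cos (b + c * r x)) \<partial>N)" for b c
    using weighted by simp
  \<comment> \<open>With phase and frequency 0 the two summands on each side coincide, so the
    integrals without a cosine agree. Cancelling them in the instance with phase \<open>a\<close>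
    and frequency 1 leaves the claim.\<close>
  show ?thesis
    using eq[of 0 0] eq[of a 1] by (simp add: mult.assoc)
qed

text \<open>The indicators replace the cosine one coordinate at a time: weighted by
  \<open>1 + cos\<close> of the remaining coordinates, the law of the removed one is a finite measure, to which
  one-dimensional uniqueness applies.\<close>

lemma cos_linear_determines_boxes:
  fixes f :: "'i \<Rightarrow> 'a \<Rightarrow> real" and g :: "'i \<Rightarrow> 'b \<Rightarrow> real"
  assumes prob: "prob_space M" "prob_space N" and fin: "finite I"
    and f: "\<And>i. i \<in> I \<Longrightarrow> f i \<in> borel_measurable M"
    and g: "\<And>i. i \<in> I \<Longrightarrow> g i \<in> borel_measurable N"
    and eq: "\<And>a u. (\<integral>x. cos (a + (\<Sum>i\<in>I. u i * f i x)) \<partial>M) =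
      (\<integral>x. cos (a + (\<Sum>i\<in>I. u i * g i x)) \<partial>N)"
    and B: "\<And>i. i \<in> I \<Longrightarrow> B i \<in> sets borel"
    and J: "J \<subseteq> I"
  shows "(\<integral>x. (\<Prod>i\<in>J. indicator (B i) (f i x)) * cos (a + (\<Sum>i\<in>I - J. u i * f i x)) \<partial>M) =
    (\<integral>x. (\<Prod>i\<in>J. indicator (B i) (g i x)) * cos (a + (\<Sum>i\<in>I - J. u i * g i x)) \<partial>N)"
  using finite_subset[OF J fin] J
proof (induction J arbitrary: a u rule: finite_induct)
  case empty
  then show ?case
    using eq by simp
next
  case (insert k J)
  let ?K = "I - insert k J"
  have k: "k \<in> I" "finite J" "finite ?K" "k \<notin> ?K" "k \<notin> J" "J \<subseteq> I" "I - J = insert k ?K"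
    using insert fin by auto
  have p1: "(\<Prod>i\<in>J. indicator (B i) (z i) :: real) \<le> 1" for z :: "'i \<Rightarrow> real"
    by (rule prod_le_1) (auto simp: indicator_def)
  have "(\<integral>x. (\<Prod>i\<in>J. indicator (B i) (f i x)) * indicator (B k) (f k x) * cos (a + (\<Sum>i\<in>?K. u i * f i x)) \<partial>M) =
    (\<integral>x. (\<Prod>i\<in>J. indicator (B i) (g i x)) * indicator (B k) (g k x) * cos (a + (\<Sum>i\<in>?K. u i * g i x)) \<partial>N)"
  proof (rule cos_determines_indicator_times_cos[OF prob, where f="f k" and g="g k" and B="B k"
        and p="\<lambda>x. \<Prod>i\<in>J. indicator (B i) (f i x)" and q="\<lambda>x. \<Prod>i\<in>J. indicator (B i) (g i x)"
        and s="\<lambda>x. \<Sum>i\<in>?K. u i * f i x" and r="\<lambda>x. \<Sum>i\<in>?K. u i * g i x"])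
    have "(\<lambda>x. indicator (B i) (f i x) :: real) \<in> borel_measurable M"
      "(\<lambda>x. indicator (B i) (g i x) :: real) \<in> borel_measurable N" if "i \<in> J" for i
      using that k(6) measurable_compose[OF f borel_measurable_indicator[OF B], of i i]
        measurable_compose[OF g borel_measurable_indicator[OF B], of i i] by blast+
    then show "(\<lambda>x. \<Prod>i\<in>J. indicator (B i) (f i x) :: real) \<in> borel_measurable M"
      "(\<lambda>x. \<Prod>i\<in>J. indicator (B i) (g i x) :: real) \<in> borel_measurable N"
      by (auto intro: borel_measurable_prod)
    have "(\<lambda>x. u i * f i x) \<in> borel_measurable M" "(\<lambda>x. u i * g i x) \<in> borel_measurable N"
      if "i \<in> ?K" for i
      using that f[of i] g[of i] by simp_all
    then show "(\<lambda>x. \<Sum>i\<in>?K. u i * f i x) \<in> borel_measurable M" "(\<lambda>x. \<Sum>i\<in>?K. u i * g i x) \<in> borel_measurable N"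
      by (auto intro: borel_measurable_sum)
    show "(\<integral>x. (\<Prod>i\<in>J. indicator (B i) (f i x)) * cos (b + (t * f k x + c * (\<Sum>i\<in>?K. u i * f i x))) \<partial>M) =
      (\<integral>x. (\<Prod>i\<in>J. indicator (B i) (g i x)) * cos (b + (t * g k x + c * (\<Sum>i\<in>?K. u i * g i x))) \<partial>N)" for b t c
    proof -
      \<comment> \<open>The induction hypothesis is used with new coefficients: \<open>t\<close> at
        the coordinate \<open>k\<close> about to be removed, and the old ones scaled by
        \<open>c\<close> elsewhere. For this reason phase and coefficients are generalised in the
        induction.\<close>
      let ?u = "\<lambda>i. if i = k then t else c * u i"
      have s: "(\<Sum>i\<in>I - J. ?u i * z i) = t * z k + c * (\<Sum>i\<in>?K. u i * z i)" for z :: "'i \<Rightarrow> real"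
      proof -
        have "?u i * z i = c * (u i * z i)" if "i \<in> ?K" for i
          using that by simp
        then have "(\<Sum>i\<in>?K. ?u i * z i) = (\<Sum>i\<in>?K. c * (u i * z i))"
          by (rule sum.cong[OF refl])
        then show ?thesis
          unfolding k(7) sum.insert[OF k(3,4)] by (simp add: sum_distrib_left)
      qed
      show ?thesis
        using insert.IH[OF k(6), of b ?u] unfolding s .
    qed
  qed (fact f[OF k(1)] g[OF k(1)] B[OF k(1)] p1 | rule prod_nonneg, simp)+
  then show ?case
    using k(2,5) by (simp add: mult.commute)
qed

lemma measure_distr_restrict_box:
  fixes h :: "'i \<Rightarrow> 'a \<Rightarrow> real"
  assumes fin: "finite I" and h: "\<And>i. i \<in> I \<Longrightarrow> h i \<in> borel_measurable L"
    and B: "\<And>i. i \<in> I \<Longrightarrow> B i \<in> sets borel"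
  shows "measure (distr L (\<Pi>\<^sub>M i\<in>I. borel) (\<lambda>x. \<lambda>i\<in>I. h i x)) (Pi\<^sub>E I B) =
    (\<integral>x. (\<Prod>i\<in>I. indicator (B i) (h i x)) \<partial>L)"
proof -
  have [measurable]: "(\<lambda>x. \<lambda>i\<in>I. h i x) \<in> L \<rightarrow>\<^sub>M (\<Pi>\<^sub>M i\<in>I. borel)"
    using h by (auto intro!: measurable_restrict)
  have box[measurable]: "Pi\<^sub>E I B \<in> sets (\<Pi>\<^sub>M i\<in>I. borel)"
    using B fin by (intro sets_PiM_I_finite) auto
  have "(\<Prod>i\<in>I. indicator (B i) (h i x)) = (indicator (Pi\<^sub>E I B) (\<lambda>i\<in>I. h i x) :: real)" for x
    using fin by (cases "\<forall>i\<in>I. h i x \<in> B i") (auto simp: indicator_def PiE_iff)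
  then have "(\<integral>x. (\<Prod>i\<in>I. indicator (B i) (h i x)) \<partial>L) =
      (\<integral>x. (indicator (Pi\<^sub>E I B) (\<lambda>i\<in>I. h i x) :: real) \<partial>L)"
    by simp
  also have "\<dots> = (\<integral>z. indicator (Pi\<^sub>E I B) z \<partial>distr L (\<Pi>\<^sub>M i\<in>I. borel) (\<lambda>x. \<lambda>i\<in>I. h i x))"
    by (subst integral_distr) auto
  finally show ?thesis
    using sets.sets_into_space[OF box] by (simp add: Int_absorb2)
qed

text \<open>Cramer-Wold in cosine form: once every coordinate carries an indicator, the integrals
  are the measures of boxes, and boxes form a generator of the product sigma-algebra that is closed
  under intersection.\<close>

lemma cos_linear_determines_distr:
  fixes f :: "'i \<Rightarrow> 'a \<Rightarrow> real" and g :: "'i \<Rightarrow> 'b \<Rightarrow> real"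
  assumes prob: "prob_space M" "prob_space N" and fin: "finite I"
    and f: "\<And>i. i \<in> I \<Longrightarrow> f i \<in> borel_measurable M"
    and g: "\<And>i. i \<in> I \<Longrightarrow> g i \<in> borel_measurable N"
    and eq: "\<And>a u. (\<integral>x. cos (a + (\<Sum>i\<in>I. u i * f i x)) \<partial>M) =
      (\<integral>x. cos (a + (\<Sum>i\<in>I. u i * g i x)) \<partial>N)"
  shows "distr M (\<Pi>\<^sub>M i\<in>I. borel) (\<lambda>x. \<lambda>i\<in>I. f i x) =
    distr N (\<Pi>\<^sub>M i\<in>I. borel) (\<lambda>x. \<lambda>i\<in>I. g i x)"
proof (rule measure_eqI_PiM_finite[OF fin])
  interpret M: prob_space M by fact
  interpret N: prob_space N by fact
  have [measurable]: "(\<lambda>x. \<lambda>i\<in>I. f i x) \<in> M \<rightarrow>\<^sub>M (\<Pi>\<^sub>M i\<in>I. borel)"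
    "(\<lambda>x. \<lambda>i\<in>I. g i x) \<in> N \<rightarrow>\<^sub>M (\<Pi>\<^sub>M i\<in>I. borel)"
    using f g by (auto intro!: measurable_restrict)
  interpret DM: prob_space "distr M (\<Pi>\<^sub>M i\<in>I. borel) (\<lambda>x. \<lambda>i\<in>I. f i x)"
    by (rule M.prob_space_distr) simp
  interpret DN: prob_space "distr N (\<Pi>\<^sub>M i\<in>I. borel) (\<lambda>x. \<lambda>i\<in>I. g i x)"
    by (rule N.prob_space_distr) simp
  show "emeasure (distr M (\<Pi>\<^sub>M i\<in>I. borel) (\<lambda>x. \<lambda>i\<in>I. f i x)) (Pi\<^sub>E I B) =
      emeasure (distr N (\<Pi>\<^sub>M i\<in>I. borel) (\<lambda>x. \<lambda>i\<in>I. g i x)) (Pi\<^sub>E I B)"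
    if B: "\<And>i. i \<in> I \<Longrightarrow> B i \<in> sets borel" for B
    \<comment> \<open>For \<open>J = I\<close> and phase 0 the remaining sum is empty, so the cosine
      factor is 1.\<close>
    using cos_linear_determines_boxes[OF prob fin f g eq B order_refl, where a=0]
    by (simp add: DM.emeasure_eq_measure DN.emeasure_eq_measure measure_distr_restrict_box fin f g B)
  \<comment> \<open>The exhausting sequence required for uniqueness is constant: the whole space is
    itself a box, of finite measure.\<close>
  show "range (\<lambda>n::nat. \<Pi>\<^sub>E i\<in>I. UNIV) \<subseteq> prod_algebra I (\<lambda>i. borel :: real measure)"
    using fin by (auto intro!: prod_algebraI_finite)
  show "emeasure (distr M (\<Pi>\<^sub>M i\<in>I. borel) (\<lambda>x. \<lambda>i\<in>I. f i x)) (\<Pi>\<^sub>E i\<in>I. UNIV) \<noteq> \<infinity>" for n :: nat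
    by (simp add: DM.emeasure_eq_measure)
qed (simp_all add: space_PiM)

section \<open>Recovering a law from the expectations of |Y + t|\<close>

text \<open>The quotient is the forward difference quotient of |y - a| in a. It equals 1 for y \<le>
  a and is eventually -1 for y > a, so a possible atom at a is counted as in the distribution
  function. The reverse triangle inequality bounds it by 1, and dominated convergence
  applies.\<close>

lemma (in prob_space) abs_difference_quotient_tendsto:
  fixes Y :: "'a \<Rightarrow> real"
  assumes [measurable]: "Y \<in> borel_measurable M"
  shows "(\<lambda>n. \<integral>x. (\<bar>Y x + (- a - 1 / Suc n)\<bar> - \<bar>Y x + (- a)\<bar>) * Suc n \<partial>M)
    \<longlonglongrightarrow> 2 * cdf (distr M borel Y) a - 1"
proof -
  have "(\<lambda>n. \<integral>x. (\<bar>Y x + (- a - 1 / Suc n)\<bar> - \<bar>Y x + (- a)\<bar>) * Suc n \<partial>M)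
      \<longlonglongrightarrow> (\<integral>x. 2 * indicator {..a} (Y x) - 1 \<partial>M)"
  proof (rule integral_dominated_convergence[where w="\<lambda>_. 1"])
    have lim: "(\<lambda>n. (\<bar>y + (- a - 1 / Suc n)\<bar> - \<bar>y + (- a)\<bar>) * Suc n) \<longlonglongrightarrow> 2 * indicator {..a} y - 1"
      for y :: real
    proof (cases "y \<le> a")
      case True
      have "(\<bar>y + (- a - 1 / Suc n)\<bar> - \<bar>y + (- a)\<bar>) * Suc n = 1" for n
      proof -
        have "\<bar>y + (- a - 1 / Suc n)\<bar> = - (y + (- a - 1 / Suc n))"
          using True divide_nonneg_nonneg[of 1 "real (Suc n)"] by linarith
        then show ?thesis
          using True by (simp add: field_simps)
      qed
      then show ?thesis
        using True by simp
    next
      case False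
      then have "\<forall>\<^sub>F n in sequentially. 1 / real (Suc n) < y - a"
        by (intro order_tendstoD(2)[OF LIMSEQ_Suc[OF lim_1_over_n]]) simp
      then have "\<forall>\<^sub>F n in sequentially. (\<bar>y + (- a - 1 / Suc n)\<bar> - \<bar>y + (- a)\<bar>) * Suc n = - 1"
      proof eventually_elim
        case (elim n)
        then have "\<bar>y + (- a - 1 / Suc n)\<bar> = y + (- a - 1 / Suc n)"
          by (intro abs_of_nonneg) linarith
        then show ?case
          using False by (simp add: field_simps)
      qed
      then show ?thesis
        using False by (simp add: tendsto_eventually)
    qed
    then show "AE x in M. (\<lambda>n. (\<bar>Y x + (- a - 1 / Suc n)\<bar> - \<bar>Y x + (- a)\<bar>) * Suc n)
        \<longlonglongrightarrow> 2 * indicator {..a} (Y x) - 1"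
      by simp
    show "AE x in M. norm ((\<bar>Y x + (- a - 1 / Suc n)\<bar> - \<bar>Y x + (- a)\<bar>) * Suc n) \<le> 1" for n
    proof (rule AE_I2)
      fix x
      have "\<bar>\<bar>Y x + (- a - 1 / Suc n)\<bar> - \<bar>Y x + (- a)\<bar>\<bar> \<le> \<bar>- (1 / Suc n)\<bar>"
        using abs_triangle_ineq3[of "Y x + (- a - 1 / Suc n)" "Y x + (- a)"] by simp
      also have "\<dots> = 1 / Suc n"
        by (simp only: abs_minus_cancel abs_of_nonneg) simp
      finally show "norm ((\<bar>Y x + (- a - 1 / Suc n)\<bar> - \<bar>Y x + (- a)\<bar>) * Suc n) \<le> 1"
        unfolding real_norm_def abs_mult by (simp add: pos_le_divide_eq)
    qed
  qed simp_all
  moreover have "(\<integral>x. indicator {..a} (Y x) \<partial>M) = cdf (distr M borel Y) a"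
  proof -
    have "(\<integral>x. indicator {..a} (Y x) \<partial>M) = (\<integral>y. indicator {..a} y \<partial>distr M borel Y :: real)"
      by (subst integral_distr) auto
    then show ?thesis
      by (simp add: cdf_def)
  qed
  moreover have "integrable M (\<lambda>x. indicator {..a} (Y x) :: real)"
    by (intro integrable_const_bound[where B=1]) auto
  ultimately show ?thesis
    by (simp add: prob_space)
qed

lemma abs_shift_determines_distr:
  fixes Y :: "'a \<Rightarrow> real" and Z :: "'b \<Rightarrow> real"
  assumes "prob_space M" "prob_space N"
    and Y: "integrable M Y" and Z: "integrable N Z"
    and eq: "\<And>t. (\<integral>x. \<bar>Y x + t\<bar> \<partial>M) = (\<integral>x. \<bar>Z x + t\<bar> \<partial>N)"
  shows "distr M borel Y = distr N borel Z"
proof -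
  interpret M: prob_space M by fact
  interpret N: prob_space N by fact
  have m: "Y \<in> borel_measurable M" "Z \<in> borel_measurable N"
    using Y Z by auto
  \<comment> \<open>Integrability of \<open>Y\<close> and \<open>Z\<close> lets the integral of the
    difference split into two integrals, each covered by \<open>eq\<close>.\<close>
  have "(\<integral>x. (\<bar>Y x + s\<bar> - \<bar>Y x + t\<bar>) * c \<partial>M) = (\<integral>x. (\<bar>Z x + s\<bar> - \<bar>Z x + t\<bar>) * c \<partial>N)" for s t c
    using Y Z by (simp add: eq)
  then have "2 * cdf (distr M borel Y) a - 1 = 2 * cdf (distr N borel Z) a - 1" for a
    by (intro LIMSEQ_unique[OF M.abs_difference_quotient_tendsto[OF m(1)]])
      (simp only: N.abs_difference_quotient_tendsto[OF m(2)])
  then have "cdf (distr M borel Y) = cdf (distr N borel Z)"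
    by auto
  then show ?thesis
    using m by (intro cdf_unique M.real_distribution_distr N.real_distribution_distr) auto
qed

section \<open>Adding the limit of the averages to a linear combination\<close>

text \<open>By the reverse triangle inequality the two integrals differ by at most |t| times the L1
  distance of \<open>A m\<close> and \<open>X\<close>.\<close>

lemma tendsto_integral_abs_add:
  fixes S X :: "'a \<Rightarrow> real"
  assumes S: "integrable M S" and L1: "tendsto_L1 M A X"
  shows "(\<lambda>m. \<integral>\<omega>. \<bar>S \<omega> + t * A m \<omega>\<bar> \<partial>M) \<longlonglongrightarrow> (\<integral>\<omega>. \<bar>S \<omega> + t * X \<omega>\<bar> \<partial>M)"
proof (rule LIM_zero_cancel, rule Lim_null_comparison)
  have A: "integrable M (A m)" and X: "integrable M X" for m
    using L1 by (auto simp: tendsto_L1_def)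
  have "\<bar>(\<integral>\<omega>. \<bar>S \<omega> + t * A m \<omega>\<bar> \<partial>M) - (\<integral>\<omega>. \<bar>S \<omega> + t * X \<omega>\<bar> \<partial>M)\<bar>
      \<le> \<bar>t\<bar> * (\<integral>\<omega>. \<bar>A m \<omega> - X \<omega>\<bar> \<partial>M)" for m
  proof -
    have "\<bar>(\<integral>\<omega>. \<bar>S \<omega> + t * A m \<omega>\<bar> \<partial>M) - (\<integral>\<omega>. \<bar>S \<omega> + t * X \<omega>\<bar> \<partial>M)\<bar> =
        \<bar>\<integral>\<omega>. \<bar>S \<omega> + t * A m \<omega>\<bar> - \<bar>S \<omega> + t * X \<omega>\<bar> \<partial>M\<bar>"
      using S A X by simp
    also have "\<dots> \<le> (\<integral>\<omega>. \<bar>\<bar>S \<omega> + t * A m \<omega>\<bar> - \<bar>S \<omega> + t * X \<omega>\<bar>\<bar> \<partial>M)"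
      by (rule integral_abs_bound)
    also have "\<dots> \<le> (\<integral>\<omega>. \<bar>t\<bar> * \<bar>A m \<omega> - X \<omega>\<bar> \<partial>M)"
    proof (rule integral_mono)
      fix \<omega>
      have "\<bar>\<bar>S \<omega> + t * A m \<omega>\<bar> - \<bar>S \<omega> + t * X \<omega>\<bar>\<bar> \<le> \<bar>t * (A m \<omega> - X \<omega>)\<bar>"
        using abs_triangle_ineq3[of "S \<omega> + t * A m \<omega>" "S \<omega> + t * X \<omega>"] by (simp add: algebra_simps)
      then show "\<bar>\<bar>S \<omega> + t * A m \<omega>\<bar> - \<bar>S \<omega> + t * X \<omega>\<bar>\<bar> \<le> \<bar>t\<bar> * \<bar>A m \<omega> - X \<omega>\<bar>"
        by (simp add: abs_mult)
    qed (use S A X in auto)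
    finally show ?thesis
      by simp
  qed
  then show "\<forall>\<^sub>F m in sequentially. norm ((\<integral>\<omega>. \<bar>S \<omega> + t * A m \<omega>\<bar> \<partial>M) - (\<integral>\<omega>. \<bar>S \<omega> + t * X \<omega>\<bar> \<partial>M))
      \<le> \<bar>t\<bar> * (\<integral>\<omega>. \<bar>A m \<omega> - X \<omega>\<bar> \<partial>M)"
    by simp
  show "(\<lambda>m. \<bar>t\<bar> * (\<integral>\<omega>. \<bar>A m \<omega> - X \<omega>\<bar> \<partial>M)) \<longlonglongrightarrow> 0"
    using L1 by (intro tendsto_mult_right_zero) (simp add: tendsto_L1_def)
qed

text \<open>Averages over more than \<open>n\<close> terms are unaffected by permutations of the first \<open>n\<close> indices,
  so they can be added to a linear combination for free.\<close>

lemma swap_invariant_add_limit: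
  assumes swap: "swap_invariant M \<xi>" and L1: "tendsto_L1 M (average \<xi>) X"
    and \<pi>: "\<pi> permutes {1..n}"
  shows "(\<integral>\<omega>. \<bar>(\<Sum>j=1..n. u j * \<xi> j \<omega>) + t * X \<omega>\<bar> \<partial>M) =
    (\<integral>\<omega>. \<bar>(\<Sum>j=1..n. u j * \<xi> (\<pi> j) \<omega>) + t * X \<omega>\<bar> \<partial>M)"
proof (rule LIMSEQ_unique[OF tendsto_integral_abs_add[OF _ L1]])
  have int: "integrable M (\<xi> j)" if "j \<ge> 1" for j
    using swap that by (auto simp: swap_invariant_def integrable_sequence_def)
  have \<pi>1: "\<pi> j \<ge> 1" if "j \<in> {1..n}" for j
    using permutes_in_image[OF \<pi>, of j] that by simp
  show "integrable M (\<lambda>\<omega>. \<Sum>j=1..n. u j * \<xi> j \<omega>)"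
    using int by auto
  have "(\<lambda>m. \<integral>\<omega>. \<bar>(\<Sum>j=1..n. u j * \<xi> (\<pi> j) \<omega>) + t * average \<xi> m \<omega>\<bar> \<partial>M)
      \<longlonglongrightarrow> (\<integral>\<omega>. \<bar>(\<Sum>j=1..n. u j * \<xi> (\<pi> j) \<omega>) + t * X \<omega>\<bar> \<partial>M)"
    by (rule tendsto_integral_abs_add[OF _ L1]) (use int \<pi>1 in auto)
  moreover have "\<forall>\<^sub>F m in sequentially.
      (\<integral>\<omega>. \<bar>(\<Sum>j=1..n. u j * \<xi> (\<pi> j) \<omega>) + t * average \<xi> m \<omega>\<bar> \<partial>M) =
      (\<integral>\<omega>. \<bar>(\<Sum>j=1..n. u j * \<xi> j \<omega>) + t * average \<xi> m \<omega>\<bar> \<partial>M)"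
    \<comment> \<open>The bound \<open>Suc n\<close> gives both n \<le> m, so that the permutation
      acts within the first \<open>m\<close> indices, and m \<ge> 1, as swap-invariance
      demands.\<close>
    using eventually_ge_at_top[of "Suc n"]
  proof eventually_elim
    case (elim m)
    \<comment> \<open>These coefficients absorb \<open>t\<close> times the average: each of the
      \<open>m\<close> terms receives an extra \<open>t / m\<close>.\<close>
    let ?v = "\<lambda>j. (if j \<in> {1..n} then u j else 0) + t / m"
    have \<pi>m: "\<pi> permutes {1..m}"
      by (rule permutes_subset[OF \<pi>]) (use elim in auto)
    have split: "(\<Sum>j=1..m. ?v j * x j) = (\<Sum>j=1..n. u j * x j) + t / m * (\<Sum>j=1..m. x j)" for x :: "nat \<Rightarrow> real"
    proof -
      have "(\<Sum>j=1..m. ?v j * x j) =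
          (\<Sum>j=1..m. if j \<in> {1..n} then u j * x j else 0) + (\<Sum>j=1..m. t / m * x j)"
        unfolding sum.distrib[symmetric] by (intro sum.cong) (auto simp: algebra_simps)
      also have "(\<Sum>j=1..m. if j \<in> {1..n} then u j * x j else 0) = (\<Sum>j=1..n. u j * x j)"
        using elim by (intro sum.mono_neutral_cong_right) auto
      finally show ?thesis
        by (simp add: sum_distrib_left)
    qed
    have perm: "(\<Sum>j=1..m. \<xi> (\<pi> j) \<omega>) = (\<Sum>j=1..m. \<xi> j \<omega>)" for \<omega>
      using sum.permute[OF \<pi>m, of "\<lambda>j. \<xi> j \<omega>"] by (simp add: o_def)
    have "(\<integral>\<omega>. \<bar>\<Sum>j=1..m. ?v j * \<xi> j \<omega>\<bar> \<partial>M) = (\<integral>\<omega>. \<bar>\<Sum>j=1..m. ?v j * \<xi> (\<pi> j) \<omega>\<bar> \<partial>M)"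
      using swap \<pi>m elim unfolding swap_invariant_def by auto
    then show ?case
      unfolding split perm by (simp add: average_def)
  qed
  ultimately show "(\<lambda>m. \<integral>\<omega>. \<bar>(\<Sum>j=1..n. u j * \<xi> j \<omega>) + t * average \<xi> m \<omega>\<bar> \<partial>M)
      \<longlonglongrightarrow> (\<integral>\<omega>. \<bar>(\<Sum>j=1..n. u j * \<xi> (\<pi> j) \<omega>) + t * X \<omega>\<bar> \<partial>M)"
    by (rule Lim_transform_eventually)
qed

section \<open>Change of measure and exchangeability of the quotients\<close>

theorem theorem3p6:
  fixes P :: "'a measure"
    and \<xi> :: "nat \<Rightarrow> 'a \<Rightarrow> real"
    and X :: "'a \<Rightarrow> real"
  assumes "prob_space P"
    and "random_sequence P \<xi>"
    and "swap_invariant P \<xi>"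
    and "X \<in> borel_measurable P"
    and "\<P>(\<omega> in P. X \<omega> \<noteq> 0) = 1"
    and "AE \<omega> in P. (\<lambda>n. average \<xi> n \<omega>) \<longlonglongrightarrow> X \<omega>"
    and "tendsto_L1 P (average \<xi>) X"
  shows "prob_space (abs_weighted P X) \<and>
    (\<exists>\<eta> :: nat \<Rightarrow> 'a \<Rightarrow> real.
       random_sequence P \<eta> \<and>
       exchangeable (abs_weighted P X) \<eta> \<and>
       integrable_sequence (abs_weighted P X) \<eta> \<and>
       (AE \<omega> in P. \<forall>j\<ge>1. \<xi> j \<omega> = X \<omega> * \<eta> j \<omega>))"
proof -
  interpret P: prob_space P
    by fact
  note [measurable] = \<open>X \<in> borel_measurable P\<close>
  have \<xi>[measurable]: "\<xi> j \<in> borel_measurable P" and int\<xi>: "integrable P (\<xi> j)" if "j \<ge> 1" for j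
    using assms(2,3) that
    by (auto simp: random_sequence_def swap_invariant_def integrable_sequence_def)
  have intX: "integrable P X"
    using assms(7) by (simp add: tendsto_L1_def)
  have X0: "AE \<omega> in P. X \<omega> \<noteq> 0"
    using assms(5) by (subst (asm) P.prob_Collect_eq_1) auto
  define c where "c = (\<integral>\<omega>. \<bar>X \<omega>\<bar> \<partial>P)"
  have "c \<noteq> 0"
  proof
    assume "c = 0"
    then have "AE \<omega> in P. X \<omega> = 0"
      using intX by (simp add: c_def integral_nonneg_eq_0_iff_AE)
    with X0 have "AE \<omega> in P. False"
      by eventually_elim simp
    then show False
      by simp
  qed
  moreover have "c \<ge> 0"
    by (simp add: c_def)
  ultimately have c: "c > 0"
    by simp
  define Q where "Q = abs_weighted P X"
  have Q: "Q = density P (\<lambda>\<omega>. ennreal (\<bar>X \<omega>\<bar> / c))"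
    by (simp add: Q_def abs_weighted_def c_def)
  have setsQ[measurable_cong]: "sets Q = sets P"
    by (simp add: Q)
  have "prob_space Q"
    unfolding Q using intX c c_def
    by (intro prob_spaceI)
      (simp add: emeasure_density nn_integral_eq_integral cong: nn_integral_cong_simp)
  then interpret Q: prob_space Q .
  \<comment> \<open>Division by zero yields 0, so the quotient is total; its values where
    \<open>X\<close> vanishes matter only on a null set.\<close>
  define \<eta> where "\<eta> j \<omega> = \<xi> j \<omega> / X \<omega>" for j \<omega>
  have \<eta>[measurable]: "\<eta> j \<in> borel_measurable P" if "j \<ge> 1" for j
    using \<xi>[OF that] by (simp add: \<eta>_def[abs_def])
  have int\<eta>: "integrable Q (\<eta> j)" if "j \<ge> 1" for j
  proof -
    have "integrable P (\<lambda>\<omega>. (\<bar>X \<omega>\<bar> / c) *\<^sub>R \<eta> j \<omega>)"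
    \<comment> \<open>The density cancels the denominator: in absolute value the integrand equals
      |\<xi> j| / c where \<open>X\<close> is nonzero, and is 0 elsewhere.\<close>
    proof (rule Bochner_Integration.integrable_bound)
      show "integrable P (\<lambda>\<omega>. \<xi> j \<omega> / c)"
        using int\<xi>[OF that] by simp
      show "(\<lambda>\<omega>. (\<bar>X \<omega>\<bar> / c) *\<^sub>R \<eta> j \<omega>) \<in> borel_measurable P"
        using \<eta>[OF that] by simp
    qed (use c in \<open>auto simp: \<eta>_def abs_mult\<close>)
    then show ?thesis
      unfolding Q using \<eta>[OF that] c by (subst integrable_density) auto
  qed
  \<comment> \<open>The factor |X| of the density is pulled into the absolute value, turning \<eta>
    into \<xi> and the constant \<open>t\<close> into \<open>t * X\<close>. A general index map
    \<pi> covers both the permuted and the original combination; it must avoid index 0, where \<xi>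
    is unconstrained.\<close>
  have Q_abs: "(\<integral>\<omega>. \<bar>(\<Sum>j=1..n. u j * \<eta> (\<pi> j) \<omega>) + t\<bar> \<partial>Q) =
      (\<integral>\<omega>. \<bar>(\<Sum>j=1..n. u j * \<xi> (\<pi> j) \<omega>) + t * X \<omega>\<bar> \<partial>P) / c"
    if \<pi>: "\<And>j. j \<in> {1..n} \<Longrightarrow> \<pi> j \<ge> 1" for n u \<pi> t
  proof -
    have [measurable]: "(\<lambda>\<omega>. \<Sum>j=1..n. u j * \<eta> (\<pi> j) \<omega>) \<in> borel_measurable P"
      "(\<lambda>\<omega>. \<Sum>j=1..n. u j * \<xi> (\<pi> j) \<omega>) \<in> borel_measurable P"
      using \<pi> \<eta> \<xi> by auto
    have "(\<integral>\<omega>. \<bar>(\<Sum>j=1..n. u j * \<eta> (\<pi> j) \<omega>) + t\<bar> \<partial>Q) =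
        (\<integral>\<omega>. (\<bar>X \<omega>\<bar> / c) *\<^sub>R \<bar>(\<Sum>j=1..n. u j * \<eta> (\<pi> j) \<omega>) + t\<bar> \<partial>P)"
      unfolding Q using c by (subst integral_density) auto
    also have "\<dots> = (\<integral>\<omega>. \<bar>(\<Sum>j=1..n. u j * \<xi> (\<pi> j) \<omega>) + t * X \<omega>\<bar> / c \<partial>P)"
    proof (rule integral_cong_AE)
      show "AE \<omega> in P. (\<bar>X \<omega>\<bar> / c) *\<^sub>R \<bar>(\<Sum>j=1..n. u j * \<eta> (\<pi> j) \<omega>) + t\<bar> =
          \<bar>(\<Sum>j=1..n. u j * \<xi> (\<pi> j) \<omega>) + t * X \<omega>\<bar> / c"
        using X0
      proof eventually_elim
        case (elim \<omega>)
        then have "X \<omega> * ((\<Sum>j=1..n. u j * \<eta> (\<pi> j) \<omega>) + t) = (\<Sum>j=1..n. u j * \<xi> (\<pi> j) \<omega>) + t * X \<omega>"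
          by (simp add: \<eta>_def distrib_left sum_distrib_left)
        then show ?case
          by (simp flip: abs_mult)
      qed
    qed simp_all
    finally show ?thesis
      by simp
  qed
  have "exchangeable Q \<eta>"
    unfolding exchangeable_def
  proof (intro conjI allI impI)
    show "random_sequence Q \<eta>"
      using \<eta> by (simp add: random_sequence_def measurable_cong_sets[OF setsQ refl])
    fix n \<pi>
    assume \<pi>: "\<pi> permutes {1..n::nat}"
    have \<pi>1: "\<pi> j \<ge> 1" if "j \<in> {1..n}" for j
      using permutes_in_image[OF \<pi>, of j] that by simp
    have meas: "\<eta> j \<in> borel_measurable Q" if "j \<ge> 1" for j
      using int\<eta>[OF that] by simp
    show "distr Q (\<Pi>\<^sub>M j\<in>{1..n}. borel) (\<lambda>\<omega>. \<lambda>j\<in>{1..n}. \<eta> (\<pi> j) \<omega>) =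
        distr Q (\<Pi>\<^sub>M j\<in>{1..n}. borel) (\<lambda>\<omega>. \<lambda>j\<in>{1..n}. \<eta> j \<omega>)"
    proof (rule cos_linear_determines_distr[OF \<open>prob_space Q\<close> \<open>prob_space Q\<close>])
      fix a :: real and u :: "nat \<Rightarrow> real"
      let ?Y = "\<lambda>\<omega>. \<Sum>j=1..n. u j * \<eta> (\<pi> j) \<omega>" and ?Z = "\<lambda>\<omega>. \<Sum>j=1..n. u j * \<eta> j \<omega>"
      have int: "integrable Q ?Y" "integrable Q ?Z"
        using int\<eta> \<pi>1 by auto
      have "(\<integral>\<omega>. \<bar>?Y \<omega> + t\<bar> \<partial>Q) = (\<integral>\<omega>. \<bar>?Z \<omega> + t\<bar> \<partial>Q)" for t
        using Q_abs[of n \<pi> u t, OF \<pi>1] Q_abs[of n "\<lambda>j. j" u t]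
          swap_invariant_add_limit[OF assms(3,7) \<pi>, of u t] by simp
      \<comment> \<open>Equality for every shift \<open>t\<close> determines the one-dimensional
        law; cosines are then integrated against this common law.\<close>
      then have same_law: "distr Q borel ?Y = distr Q borel ?Z"
        using int by (intro abs_shift_determines_distr) (rule \<open>prob_space Q\<close>)+
      have "(\<integral>y. cos (a + y) \<partial>distr Q borel W) = (\<integral>\<omega>. cos (a + W \<omega>) \<partial>Q)"
        if "integrable Q W" for W
        using that by (subst integral_distr) auto
      from this[OF int(1)] this[OF int(2)]
      show "(\<integral>\<omega>. cos (a + ?Y \<omega>) \<partial>Q) = (\<integral>\<omega>. cos (a + ?Z \<omega>) \<partial>Q)"
        by (simp only: same_law)
    qed (use meas \<pi>1 in simp_all)
  qed
  moreover have "AE \<omega> in P. \<forall>j\<ge>1. \<xi> j \<omega> = X \<omega> * \<eta> j \<omega>"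
    using X0 by eventually_elim (simp add: \<eta>_def)
  moreover have "random_sequence P \<eta>" "integrable_sequence Q \<eta>"
    using \<eta> int\<eta> by (auto simp: random_sequence_def integrable_sequence_def)
  ultimately show ?thesis
    using \<open>prob_space Q\<close> unfolding Q_def by (intro conjI exI[of _ \<eta>])
qed

end
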